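(* Let $k$ be a field and let $A$ be a standard graded $k$-algebra of Krull dimension $d$ with Hilbert series $$\mathrm{Hilb}(A,t) = \frac{h_0 + \cdots + h_s t^s}{(1-t)^{d}}.$$ Then for every integer $r \geq 1$ the Hilbert series of the $r$th Veronese algebra $A^{\langle r\rangle}$ is $$\mathrm{Hilb}(A^{\langle r \rangle},t) = \frac{h_0^{\langle r \rangle} + \cdots + h_m^{\langle r \rangle} t^m}{(1-t)^{d}},$$ where $m := \max(s,d)$ and $$h_i^{\langle r \rangle} = \sum_{j=0}^s C(r-1,d,ir-j)\, h_j \qquad \text{for } i=0,\ldots,m.$$
   Context: A standard graded $k$-algebra is a graded $k$-algebra $A = \bigoplus_{n\ge 0} A_n$ (commutative) with $A_0 = k$ that is finitely generated as a $k$-algebra by elements of degree $1$. Its Hilbert series is $\mathrm{Hilb}(A,t) = \sum_{n\ge 0} \dim_k A_n\, t^n$; by the Hilbert–Serre theorem it has the form $h(t)/(1-t)^d$ with $h(t)$ a polynomial, $h(1)\geq 1$, and $d$ the Krull dimension of $A$. The $r$th Veronese algebra is $A^{\langle r\rangle} = \bigoplus_{n\ge 0} A_{nr}$, where $A_{nr}$ is the component of degree $n$, so $\mathrm{Hilb}(A^{\langle r\rangle},t) = \sum_{n\ge 0} \dim_k A_{rn}\, t^n$. For integers $r \geq 0$, $d \geq 1$ and $i \ge 0$, $C(r,d,i)$ denotes the number of tuples $(a_1,\ldots,a_d)$ of nonnegative integers with $a_1+\cdots+a_d = i$ and $a_j \leq r$ for all $1 \leq j \leq d$. For $d=0$, $C(r,0,i)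 = \delta_{0,i}$. For $i<0$, $C(r,d,i)=0$. *)

theory Defs
  imports
    "Jordan_Normal_Form.Missing_VectorSpace"
    "HOL-Algebra.Ideal"
    "HOL-Algebra.Generated_Rings"
    "HOL-Library.Extended_Nat"
    "HOL-Computational_Algebra.Formal_Power_Series"
begin

definition homogeneous_decomposition ::
    "('k, 'a) module \<Rightarrow> (nat \<Rightarrow> 'a set) \<Rightarrow> 'a \<Rightarrow> (nat \<Rightarrow> 'a) \<Rightarrow> bool" where
  "homogeneous_decomposition A G x f \<longleftrightarrow>
     (\<forall>n. f n \<in> G n) \<and> finite {n. f n \<noteq> \<zero>\<^bsub>A\<^esub>} \<and> x = finsum A f {n. f n \<noteq> \<zero>\<^bsub>A\<^esub>}"

locale graded_algebra =
  fixes K :: "'k ring" and A :: "('k, 'a) module" and G :: "nat \<Rightarrow> 'a set"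
  assumes field: "field K"
    and algebra: "algebra K A"
    and component: "LinearCombinations.submodule K (G n) A"
    and graded_mult: "x \<in> G m \<Longrightarrow> y \<in> G n \<Longrightarrow> x \<otimes>\<^bsub>A\<^esub> y \<in> G (m + n)"
    and decomposition: "x \<in> carrier A \<Longrightarrow> \<exists>!f. homogeneous_decomposition A G x f"

text \<open>
  The bijection expresses the equality of the degree zero component with the ground field; in
  particular it excludes the zero ring. The subring generated by the image of the field together
  with \<open>S\<close> is the subalgebra generated by \<open>S\<close>.
\<close>

locale standard_graded_algebra = graded_algebra +
  assumes degree_zero: "bij_betw (\<lambda>c. c \<odot>\<^bsub>A\<^esub> \<one>\<^bsub>A\<^esub>) (carrier K) (G 0)"
    and generated: "\<exists>S. finite S \<and> S \<subseteq> G 1 \<and>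
          generate_ring A ((\<lambda>c. c \<odot>\<^bsub>A\<^esub> \<one>\<^bsub>A\<^esub>) ` carrier K \<union> S) = carrier A"

definition krull_dim :: "('a, 'm) ring_scheme \<Rightarrow> enat" where
  "krull_dim R = Sup {enat n | n. \<exists>P :: nat \<Rightarrow> 'a set.
     (\<forall>i\<le>n. primeideal (P i) R) \<and> (\<forall>i<n. P i \<subset> P (Suc i))}"

text \<open>
  The coefficients are taken in a field so that the quotient by a power of \<open>1 - t\<close> can be written
  as a division of formal power series. The dimension of a component is only meaningful when it is
  finite, as is the case for standard graded algebras and their Veronese algebras.
\<close>

definition hilbert_series :: "'k ring \<Rightarrow> ('k, 'a) module \<Rightarrow> (nat \<Rightarrow> 'a set) \<Rightarrow> rat fps" where
  "hilbert_series K A G = Abs_fps (\<lambda>n. of_nat (vectorspace.dim K (A\<lparr>carrier := G n\<rparr>)))"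

definition veronese_grading :: "nat \<Rightarrow> (nat \<Rightarrow> 'a set) \<Rightarrow> nat \<Rightarrow> 'a set" where
  "veronese_grading r G n = G (n * r)"

definition veronese_algebra ::
    "nat \<Rightarrow> ('k, 'a) module \<Rightarrow> (nat \<Rightarrow> 'a set) \<Rightarrow> ('k, 'a) module" where
  "veronese_algebra r A G =
     A\<lparr>carrier := {x. \<exists>f. homogeneous_decomposition A (veronese_grading r G) x f}\<rparr>"

text \<open>
  The index \<open>i\<close> is an integer because negative indices occur; there, the set is empty. For
  \<open>d = 0\<close> the only list is the empty one, which yields the Kronecker delta.
\<close>

definition C :: "nat \<Rightarrow> nat \<Rightarrow> int \<Rightarrow> nat" where
  "C r d i = card {a :: nat list. length a = d \<and> int (sum_list a) = i \<and> (\<forall>x\<in>set a. x \<le> r)}"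

end

theory Submission
  imports Defs
begin

text \<open>
  Passing to the Veronese algebra replaces the Hilbert series \<open>H\<close> by the series that keeps every
  \<open>r\<close>th coefficient of \<open>H\<close>, so the claim is one about the operator \<open>fps_section\<close> below. This
  operator is linear over the power series in \<open>t^r\<close>: a factor \<open>g(t^r)\<close> comes out as \<open>g(t)\<close>
  (lemma \<open>fps_section_one_minus_X_power_mult\<close> for \<open>g = (1 - t)^d\<close>). The numerator and the
  denominator of \<open>H = h(t) / (1 - t)^d\<close> are therefore multiplied by \<open>(1 + t + \<dots> + t^(r-1))^d\<close>,
  which turns the denominator into \<open>(1 - t^r)^d\<close>. The coefficients of this factor are exactly the
  numbers \<open>C(r - 1, d, i)\<close> (lemma \<open>fps_nth_geometric_power\<close>), and the sum in the claim is the
  coefficient of \<open>t^(ir)\<close> in \<open>h(t) (1 + t + \<dots> + t^(r-1))^d\<close>. It vanishes for \<open>i > max s d\<close>,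
  because the degree of this product is at most \<open>s + d(r - 1) < ir\<close> for such \<open>i\<close>.
\<close>

unbundle fps_syntax

section \<open>Bounded compositions as coefficients of a power of a geometric sum\<close>

lemma C_negative: "i < 0 \<Longrightarrow> C q d i = 0"
  by (simp add: C_def)

lemma C_0: "C q 0 i = (if i = 0 then 1 else 0)"
proof -
  have "{a :: nat list. length a = 0 \<and> int (sum_list a) = i \<and> (\<forall>x\<in>set a. x \<le> q)}
          = (if i = 0 then {[]} else {})"
    by auto
  then show ?thesis by (simp add: C_def)
qed

lemma C_Suc: "C q (Suc d) i = (\<Sum>x\<le>q. C q d (i - int x))"
proof -
  define S where
    "S d i = {a :: nat list. length a = d \<and> int (sum_list a) = i \<and> (\<forall>x\<in>set a. x \<le> q)}" for d i
  have fin: "finite (S d i)" for d i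
    by (rule finite_subset[OF _ finite_lists_length_eq[of "{..q}" d]]) (auto simp: S_def)
  have "S (Suc d) i = (\<Union>x\<le>q. Cons x ` S d (i - int x))"
    by (auto simp: S_def length_Suc_conv image_iff)
  then have "card (S (Suc d) i) = (\<Sum>x\<le>q. card (Cons x ` S d (i - int x)))"
    by (simp only:) (rule card_UN_disjoint; auto simp: fin)
  then show ?thesis
    by (simp add: C_def S_def card_image)
qed

lemma C_beyond: "int (d * q) < i \<Longrightarrow> C q d i = 0"
proof (induction d arbitrary: i)
  case 0
  then show ?case by (simp add: C_0)
next
  case (Suc d)
  have "C q d (i - int x) = 0" if "x \<le> q" for x
    using Suc.prems that by (intro Suc.IH) simp
  then show ?case by (simp add: C_Suc)
qed

lemma fps_nth_polynomial_mult:
  fixes f :: "'a::comm_ring_1 fps"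
  shows "((\<Sum>i\<le>s. fps_const (c i) * fps_X ^ i) * f) $ n
           = (\<Sum>i\<le>s. c i * (if n < i then 0 else f $ (n - i)))"
  by (simp add: sum_distrib_right fps_sum_nth mult.assoc fps_X_power_mult_nth)

lemma fps_nth_geometric_power:
  "((\<Sum>i\<le>q. fps_X ^ i) ^ d :: 'a::comm_ring_1 fps) $ n = of_nat (C q d (int n))"
proof (induction d arbitrary: n)
  case 0
  then show ?case by (simp add: C_0)
next
  case (Suc d)
  have "((\<Sum>i\<le>q. fps_X ^ i) ^ Suc d :: 'a fps) $ n
          = (\<Sum>i\<le>q. if n < i then 0 else of_nat (C q d (int (n - i))))"
    using fps_nth_polynomial_mult[of "\<lambda>_. 1" q "(\<Sum>i\<le>q. fps_X ^ i) ^ d :: 'a fps" n]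
    by (simp add: Suc.IH cong: if_cong)
  also have "\<dots> = (\<Sum>i\<le>q. of_nat (C q d (int n - int i)))"
    by (intro sum.cong) (auto simp: C_negative of_nat_diff)
  finally show ?case by (simp add: C_Suc)
qed

section \<open>Keeping every \<open>r\<close>th coefficient of a power series\<close>

definition fps_section :: "nat \<Rightarrow> 'a fps \<Rightarrow> 'a fps" where
  "fps_section r f = Abs_fps (\<lambda>n. f $ (n * r))"

lemma fps_section_one_minus_X_power_mult:
  fixes f :: "'a::comm_ring_1 fps"
  assumes "r \<ge> 1"
  shows "fps_section r ((1 - fps_X ^ r) ^ d * f) = (1 - fps_X) ^ d * fps_section r f"
proof (induction d)
  case 0
  then show ?case by simp
next
  case (Suc d)
  have one_factor: "fps_section r ((1 - fps_X ^ r) * g) = (1 - fps_X) * fps_section r g"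
    for g :: "'a fps"
  proof (rule fps_ext)
    fix n
    show "fps_section r ((1 - fps_X ^ r) * g) $ n = ((1 - fps_X) * fps_section r g) $ n"
      using assms
      by (cases n) (simp_all add: fps_section_def left_diff_distrib fps_X_power_mult_nth)
  qed
  show ?case
    by (simp add: mult.assoc one_factor Suc.IH)
qed

text \<open>
  The upper limit \<open>max s d\<close> makes the sum finite without losing a term: for larger \<open>i\<close> one has
  \<open>ir - j \<ge> i(r - 1) + (i - s) > d(r - 1)\<close>, and no list of \<open>d\<close> entries, each at most \<open>r - 1\<close>, has
  such a large sum.
\<close>

lemma fps_section_rational:
  fixes h :: "nat \<Rightarrow> 'a::field"
  assumes r: "r \<ge> 1"
  shows "fps_section r ((\<Sum>i\<le>s. fps_const (h i) * fps_X ^ i) / (1 - fps_X) ^ d) =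
           (\<Sum>i\<le>max s d.
              fps_const (\<Sum>j\<le>s. of_nat (C (r - 1) d (int i * int r - int j)) * h j) * fps_X ^ i)
           / (1 - fps_X) ^ d"
    (is "fps_section r (?p / ?D) = ?q / ?D")
proof -
  define g :: "'a fps" where "g = (\<Sum>i\<le>r - 1. fps_X ^ i)"
  have unit: "?D $ 0 \<noteq> 0"
    by (simp add: fps_nth_power_0)
  have cancel: "?D * (f / ?D) = f" for f
    using unit by (simp add: fps_divide_unit inverse_mult_eq_1' mult.left_commute[of ?D f])
  have "{..r - 1} = {..<r}"
    using r by auto
  then have geometric: "1 - fps_X ^ r = g * (1 - fps_X)"
    by (simp add: g_def one_diff_power_eq mult.commute)
  have "?D * fps_section r (?p / ?D) = fps_section r ((1 - fps_X ^ r) ^ d * (?p / ?D))"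
    using r by (simp add: fps_section_one_minus_X_power_mult)
  also have "(1 - fps_X ^ r) ^ d * (?p / ?D) = ?p * g ^ d"
    by (simp only: geometric power_mult_distrib mult.assoc cancel mult.commute)
  also have "fps_section r (?p * g ^ d) = ?q"
  proof (rule fps_ext)
    fix n
    let ?c = "\<lambda>i. \<Sum>j\<le>s. of_nat (C (r - 1) d (int i * int r - int j)) * h j"
    have vanish: "?c n = 0" if "n > max s d"
    proof -
      have "C (r - 1) d (int n * int r - int j) = 0" if "j \<le> s" for j
      proof (rule C_beyond)
        have "d * (r - 1) + j < n * (r - 1) + n"
          using \<open>n > max s d\<close> that by (intro add_le_less_mono mult_le_mono1) auto
        also have "\<dots> = n * r"
          using r by (cases r) simp_all
        finally have "int (d * (r - 1) + j) < int (n * r)"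
          by (simp only: of_nat_less_iff)
        then show "int (d * (r - 1)) < int n * int r - int j"
          by simp
      qed
      then show ?thesis by simp
    qed
    have "fps_section r (?p * g ^ d) $ n
            = (\<Sum>j\<le>s. h j * (if n * r < j then 0 else of_nat (C (r - 1) d (int (n * r - j)))))"
      by (simp add: fps_section_def fps_nth_polynomial_mult g_def fps_nth_geometric_power
          cong: if_cong)
    also have "\<dots> = ?c n"
    proof (rule sum.cong)
      fix j
      show "h j * (if n * r < j then 0 else of_nat (C (r - 1) d (int (n * r - j))))
              = of_nat (C (r - 1) d (int n * int r - int j)) * h j"
      proof (cases "n * r < j")
        case True
        then have "int n * int r - int j < 0"
          by (simp flip: of_nat_mult)
        with True show ?thesis by (simp add: C_negative)
      qed (simp add: of_nat_diff)
    qed simp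
    also have "\<dots> = (\<Sum>i\<le>max s d. if i = n then ?c i else 0)"
      using vanish by (simp only: sum.delta finite_atMost atMost_iff) (metis not_le)
    also have "\<dots> = ?q $ n"
      by (simp add: fps_sum_nth if_distrib eq_commute[of n] cong: if_cong)
    finally show "fps_section r (?p * g ^ d) $ n = ?q $ n" .
  qed
  finally have "?D * fps_section r (?p / ?D) = ?D * (?q / ?D)"
    by (simp only: cancel)
  moreover have "?D \<noteq> 0"
    using unit by auto
  ultimately show ?thesis
    by (simp only: mult_cancel_left) simp
qed

section \<open>Hilbert series of Veronese algebras\<close>

text \<open>
  The \<open>n\<close>th component of the Veronese algebra has the same carrier as the component of degree
  \<open>n * r\<close> of the given algebra, and its vector space structure is inherited from that algebra.
\<close>

lemma hilbert_series_veronese: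
  "hilbert_series K (veronese_algebra r A G) (veronese_grading r G)
     = fps_section r (hilbert_series K A G)"
  by (simp add: hilbert_series_def veronese_algebra_def veronese_grading_def fps_section_def)

theorem corollary1p2:
  fixes K :: "'k ring" and A :: "('k, 'a) module" and G :: "nat \<Rightarrow> 'a set"
    and d s r :: nat and h :: "nat \<Rightarrow> rat"
  assumes "standard_graded_algebra K A G"
    and "krull_dim A = enat d"
    and "hilbert_series K A G =
           (\<Sum>i\<le>s. fps_const (h i) * fps_X ^ i) / (1 - fps_X) ^ d"
    and "r \<ge> 1"
  shows "hilbert_series K (veronese_algebra r A G) (veronese_grading r G) =
           (\<Sum>i\<le>max s d.
              fps_const (\<Sum>j\<le>s. of_nat (C (r - 1) d (int i * int r - int j)) * h j) * fps_X ^ i)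
           / (1 - fps_X) ^ d"
  using assms(3,4) by (simp only: hilbert_series_veronese fps_section_rational)

end
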